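(* Let $\{x^k\}_{k\in\mathbb{N}}$ be the sequence generated by the proximal MM algorithm described in the context. If its limit $\overline{x}$ satisfies $|\overline{x}_{\rm nz}|>\frac{2a}{\rho(a+1)}$, then $\overline{x}$ is a local minimum of the problem $\min_{x\in\mathbb{R}^p}\Theta_{\lambda,\rho}(x)$. If in addition the following constraint qualification holds: $v^1+v^2=0$ with $v^1\in\mathcal{N}_\Omega(\overline{x})$ and $v^2\in\partial\|\cdot\|_0(\overline{x})$ implies $(v^1,v^2)=(0,0)$, then $\overline{x}$ is also a local minimum of $$\min_{x\in\Omega}\Big\{f(Ax-b)+\frac{\mu}{2}\|x\|^2+\nu\|x\|_0\Big\},\qquad \nu=\lambda/\rho.$$
   Context: Data: $f:\mathbb{R}^n\to\mathbb{R}_+$ is a piecewise linear-quadratic (nonsmooth) convex function, $A\in\mathbb{R}^{n\times p}$, $b\in\mathbb{R}^n$, $\Omega\subseteq\mathbb{R}^p$ is a nonempty polyhedral (convex) set, $\mu>0$, and $F_\mu(x):=f(Ax-b)+\frac{\mu}{2}\|x\|^2$. $\delta_\Omega$ is the indicator function of $\Omega$, $\mathcal{N}_\Omega$ its normal cone, $e$ the all-ones vector, $|x|$ the vector of absolute values, $\|x\|_0$ the number of nonzero entries of $x$, and $\partial$ the limiting subdifferential. Surrogate: fix $a>1$, let $\phi(t)=\frac{a-1}{a+1}t^2+\frac{2}{a+1}t$, $\psi(t)=\phi(t)$ for $t\in[0,1]$ and $\psi(t)=+\infty$ otherwise, and let $\psi^*$ be its conjugate, i.e. $\psi^*(s)=0$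 if $s\le\frac{2}{a+1}$, $\psi^*(s)=\frac{((a+1)s-2)^2}{4(a^2-1)}$ if $\frac{2}{a+1}<s\le\frac{2a}{a+1}$, and $\psi^*(s)=s-1$ if $s>\frac{2a}{a+1}$. For $\lambda,\rho>0$, $$\Theta_{\lambda,\rho}(x):=F_\mu(x)+\delta_\Omega(x)+\lambda\|x\|_1-\lambda\rho^{-1}\sum_{i=1}^p\psi^*(\rho|x_i|),\qquad w_\rho(x):=\big((\psi^* )'(\rho|x_1|),\ldots,(\psi^* )'(\rho|x_p|)\big)^{\mathbb{T}}.$$ Algorithm (proximal MM method for minimizing $\Theta_{\lambda,\rho}$; run without stopping): choose $\lambda>0$, $\gamma_{1,0}>0$, $\gamma_{2,0}>0$, $\underline{\gamma_1}>0$, $\underline{\gamma_2}>0$, $\varrho\in(0,1]$, $\rho\ge1$ and $x^0\in\Omega$. For $k=0,1,2,\ldots$: set $w^k=w_\rho(x^k)$; let $x^{k+1}$ be the optimal solution of $$\min_{x\in\Omega}\Big\{F_\mu(x)+\lambda\langle e-w^k,|x|\rangle+\frac{\gamma_{1,k}}{2}\|x-x^k\|^2+\frac{\gamma_{2,k}}{2}\|Ax-Ax^k\|^2\Big\};$$ set $\gamma_{1,k+1}=\max(\underline{\gamma_1},\varrho\gamma_{1,k})$ and $\gamma_{2,k+1}=\max(\underline{\gamma_2},\varrho\gamma_{1,k})$. (The sequence $\{x^k\}$ is convergent.) For a vector $x$, $|x_{\rm nz}|$ denotes the smallest absolute value among the nonzero entries of $x$. *)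

theory Defs
  imports "HOL-Analysis.Analysis"
begin

section \<open>Convex and variational analysis\<close>

text \<open>
  Rockafellar and Wets, Variational Analysis, Definition 10.20, for a function that is finite
  everywhere, so that the polyhedral sets cover the whole space.
\<close>

definition piecewise_linear_quadratic :: "(real ^ 'n \<Rightarrow> real) \<Rightarrow> bool" where
  "piecewise_linear_quadratic f \<longleftrightarrow>
     (\<exists>\<C>. finite \<C> \<and> (\<forall>C\<in>\<C>. polyhedron C) \<and> \<Union>\<C> = UNIV \<and>
          (\<forall>C\<in>\<C>. \<exists>Q q c. transpose Q = Q \<and>
             (\<forall>x\<in>C. f x = (1/2) * (x \<bullet> (Q *v x)) + q \<bullet> x + c)))"

definition indicator_fun :: "'a set \<Rightarrow> 'a \<Rightarrow> ereal" where
  "indicator_fun S x = (if x \<in> S then 0 else \<infinity>)"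

text \<open>The normal cone of convex analysis, which is only used for convex sets.\<close>

definition normal_cone :: "'a::real_inner set \<Rightarrow> 'a \<Rightarrow> 'a set" where
  "normal_cone S x = (if x \<in> S then {v. \<forall>y\<in>S. v \<bullet> (y - x) \<le> 0} else {})"

text \<open>Regular (Frechet) and limiting subdifferential; Rockafellar and Wets, Definition 8.3.\<close>

definition regular_subdifferential :: "('a::real_inner \<Rightarrow> ereal) \<Rightarrow> 'a \<Rightarrow> 'a set" where
  "regular_subdifferential g x =
     (if \<bar>g x\<bar> = \<infinity> then {}
      else {v. 0 \<le> Liminf (at x) (\<lambda>y. (g y - g x - ereal (v \<bullet> (y - x))) / ereal (norm (y - x)))})"

definition limiting_subdifferential :: "('a::real_inner \<Rightarrow> ereal) \<Rightarrow> 'a \<Rightarrow> 'a set" where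
  "limiting_subdifferential g x =
     (if \<bar>g x\<bar> = \<infinity> then {}
      else {v. \<exists>X V. X \<longlonglongrightarrow> x \<and> (\<lambda>k. g (X k)) \<longlonglongrightarrow> g x \<and>
                  (\<forall>k. V k \<in> regular_subdifferential g (X k)) \<and> V \<longlonglongrightarrow> v})"

definition conjugate :: "(real \<Rightarrow> ereal) \<Rightarrow> real \<Rightarrow> ereal" where
  "conjugate g s = (SUP t. ereal (s * t) - g t)"

text \<open>
  Local minimum of \<open>g\<close> over \<open>S\<close>. Finiteness of the value excludes points outside the effective
  domain of an extended-valued objective.
\<close>

definition local_minimum_on :: "'a::metric_space set \<Rightarrow> ('a \<Rightarrow> ereal) \<Rightarrow> 'a \<Rightarrow> bool" where
  "local_minimum_on S g x \<longleftrightarrow>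
     x \<in> S \<and> \<bar>g x\<bar> \<noteq> \<infinity> \<and> (\<exists>\<epsilon>>0. \<forall>y \<in> S \<inter> ball x \<epsilon>. g x \<le> g y)"

section \<open>Vectors\<close>

definition norm1 :: "real ^ 'p \<Rightarrow> real" where
  "norm1 x = (\<Sum>i\<in>UNIV. \<bar>x $ i\<bar>)"

definition norm0 :: "real ^ 'p \<Rightarrow> nat" where
  "norm0 x = card {i. x $ i \<noteq> 0}"

text \<open>For the zero vector the infimum is over the empty set and equals \<open>\<infinity>\<close>.\<close>

definition min_abs_nonzero :: "real ^ 'p \<Rightarrow> ereal" where
  "min_abs_nonzero x = (INF i\<in>{i. x $ i \<noteq> 0}. ereal \<bar>x $ i\<bar>)"

section \<open>The surrogate problem\<close>

definition phi :: "real \<Rightarrow> real \<Rightarrow> real" where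
  "phi a t = (a - 1) / (a + 1) * t\<^sup>2 + 2 / (a + 1) * t"

definition psi :: "real \<Rightarrow> real \<Rightarrow> ereal" where
  "psi a t = (if t \<in> {0..1} then ereal (phi a t) else \<infinity>)"

text \<open>The conjugate of \<open>psi a\<close> is finite everywhere, see \<open>psi_star_explicit\<close> below.\<close>

definition psi_star :: "real \<Rightarrow> real \<Rightarrow> real" where
  "psi_star a s = real_of_ereal (conjugate (psi a) s)"

lemma conjugate_psi_eq:
  assumes "t0 \<in> {0..1}" and "\<And>t. t \<in> {0..1} \<Longrightarrow> s * t - phi a t \<le> s * t0 - phi a t0"
  shows "conjugate (psi a) s = ereal (s * t0 - phi a t0)"
  unfolding conjugate_def
proof (rule SUP_eqI)
  show "ereal (s * t) - psi a t \<le> ereal (s * t0 - phi a t0)" for t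
    using assms(2)[of t] by (cases "t \<in> {0..1}") (auto simp: psi_def)
next
  fix y assume "\<And>t. t \<in> UNIV \<Longrightarrow> ereal (s * t) - psi a t \<le> y"
  from this[of t0] show "ereal (s * t0 - phi a t0) \<le> y"
    using assms(1) by (simp add: psi_def)
qed

lemma conjugate_psi_explicit:
  assumes "a > 1"
  shows "conjugate (psi a) s =
    ereal (if s \<le> 2 / (a + 1) then 0
           else if s \<le> 2 * a / (a + 1) then ((a + 1) * s - 2)\<^sup>2 / (4 * (a\<^sup>2 - 1))
           else s - 1)"
proof -
  define \<alpha> where "\<alpha> = (a - 1) / (a + 1)"
  define \<beta> where "\<beta> = 2 / (a + 1)"
  have \<alpha>: "\<alpha> > 0"
    using assms by (simp add: \<alpha>_def)
  have "\<alpha> + \<beta> = ((a - 1) + 2) / (a + 1)"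
    unfolding \<alpha>_def \<beta>_def by (simp only: add_divide_distrib)
  then have sum: "\<alpha> + \<beta> = 1" using assms by simp
  have "2 * \<alpha> + \<beta> = (2 * (a - 1) + 2) / (a + 1)"
    unfolding \<alpha>_def \<beta>_def by (simp only: add_divide_distrib times_divide_eq_right)
  then have top: "2 * a / (a + 1) = 2 * \<alpha> + \<beta>" by simp
  have phi: "phi a t = \<alpha> * t\<^sup>2 + \<beta> * t" for t
    by (simp add: phi_def \<alpha>_def \<beta>_def)
  consider "s \<le> \<beta>" | "\<beta> < s" "s \<le> 2 * \<alpha> + \<beta>" | "2 * \<alpha> + \<beta> < s" by linarith
  then show ?thesis
  proof cases
    case 1
    have "s * t - phi a t \<le> s * 0 - phi a 0" if "t \<in> {0..1}" for t
    proof -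
      have "(s - \<beta>) * t \<le> 0" using 1 that by (intro mult_nonpos_nonneg) auto
      moreover have "\<alpha> * t\<^sup>2 \<ge> 0" using \<alpha> by simp
      ultimately show ?thesis by (simp add: phi algebra_simps)
    qed
    then show ?thesis using conjugate_psi_eq[of 0 s a] 1 by (simp add: phi \<beta>_def)
  next
    case 2
    define t0 where "t0 = (s - \<beta>) / (2 * \<alpha>)"
    have t0: "t0 \<in> {0..1}" and s: "s = 2 * \<alpha> * t0 + \<beta>"
      using 2 \<alpha> by (auto simp: t0_def field_simps)
    have "s * t - phi a t \<le> s * t0 - phi a t0" for t
    proof -
      have "s * t0 - phi a t0 - (s * t - phi a t) = \<alpha> * (t - t0)\<^sup>2"
        unfolding s by (simp add: phi power2_eq_square algebra_simps)
      moreover have "\<dots> \<ge> 0" using \<alpha> by simp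
      ultimately show ?thesis by linarith
    qed
    then have "conjugate (psi a) s = ereal (s * t0 - phi a t0)"
      using t0 by (intro conjugate_psi_eq) auto
    also have "s * t0 - phi a t0 = \<alpha> * t0\<^sup>2"
      unfolding s by (simp add: phi power2_eq_square algebra_simps)
    also have "\<dots> = ((a + 1) * s - 2)\<^sup>2 / (4 * (a\<^sup>2 - 1))"
    proof -
      have "(a + 1) * s - 2 = 2 * (a - 1) * t0"
      proof -
        have "a + 1 \<noteq> 0" using assms by simp
        then have "(a + 1) * \<alpha> = a - 1" and "(a + 1) * \<beta> = 2"
          unfolding \<alpha>_def \<beta>_def
          by (simp_all only: times_divide_eq_right nonzero_mult_div_cancel_left not_False_eq_True)
        moreover have "(a + 1) * s = 2 * ((a + 1) * \<alpha>) * t0 + (a + 1) * \<beta>"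
          unfolding s by (simp add: algebra_simps)
        ultimately show ?thesis by simp
      qed
      moreover have "a\<^sup>2 - 1 = (a - 1) * (a + 1)"
        by (simp add: power2_eq_square algebra_simps)
      moreover have "(2 * (a - 1) * t0)\<^sup>2 = (4 * (a - 1)) * ((a - 1) * t0\<^sup>2)"
        by (simp add: power2_eq_square algebra_simps)
      ultimately have "((a + 1) * s - 2)\<^sup>2 / (4 * (a\<^sup>2 - 1)) =
          ((4 * (a - 1)) * ((a - 1) * t0\<^sup>2)) / ((4 * (a - 1)) * (a + 1))"
        by (simp only: mult.assoc)
      also have "\<dots> = (a - 1) * t0\<^sup>2 / (a + 1)"
        using assms by (intro mult_divide_mult_cancel_left) simp
      finally show ?thesis by (simp add: \<alpha>_def)
    qed
    finally show ?thesis using 2 by (simp add: top flip: \<beta>_def)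
  next
    case 3
    have "s * t - phi a t \<le> s * 1 - phi a 1" if t: "t \<in> {0..1}" for t
    proof -
      have "s * 1 - phi a 1 - (s * t - phi a t) = (s - \<beta> - \<alpha> * (1 + t)) * (1 - t)"
        by (simp add: phi power2_eq_square algebra_simps)
      moreover have "\<alpha> * (1 + t) \<le> \<alpha> * 2" using \<alpha> t by (intro mult_left_mono) auto
      then have "(s - \<beta> - \<alpha> * (1 + t)) * (1 - t) \<ge> 0"
        using 3 t by (intro mult_nonneg_nonneg) auto
      ultimately show ?thesis by linarith
    qed
    then have "conjugate (psi a) s = ereal (s * 1 - phi a 1)"
      by (intro conjugate_psi_eq) auto
    then show ?thesis using 3 \<alpha> sum by (simp add: phi top flip: \<beta>_def)
  qed
qed

lemma psi_star_explicit:
  assumes "a > 1"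
  shows "psi_star a s =
    (if s \<le> 2 / (a + 1) then 0
     else if s \<le> 2 * a / (a + 1) then ((a + 1) * s - 2)\<^sup>2 / (4 * (a\<^sup>2 - 1))
     else s - 1)"
  by (simp add: psi_star_def conjugate_psi_explicit[OF assms])

definition F_mu :: "(real ^ 'n \<Rightarrow> real) \<Rightarrow> real ^ 'p ^ 'n \<Rightarrow> real ^ 'n \<Rightarrow> real \<Rightarrow> real ^ 'p \<Rightarrow> real" where
  "F_mu f A b \<mu> x = f (A *v x - b) + \<mu> / 2 * (norm x)\<^sup>2"

definition Theta :: "(real ^ 'n \<Rightarrow> real) \<Rightarrow> real ^ 'p ^ 'n \<Rightarrow> real ^ 'n \<Rightarrow> (real ^ 'p) set \<Rightarrow> real \<Rightarrow>
    real \<Rightarrow> real \<Rightarrow> real \<Rightarrow> real ^ 'p \<Rightarrow> ereal" where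
  "Theta f A b \<Omega> \<mu> a lam \<rho> x =
     ereal (F_mu f A b \<mu> x) + indicator_fun \<Omega> x + ereal (lam * norm1 x)
     - ereal (lam * inverse \<rho> * (\<Sum>i\<in>UNIV. psi_star a (\<rho> * \<bar>x $ i\<bar>)))"

section \<open>The proximal MM method\<close>

definition w_rho :: "real \<Rightarrow> real \<Rightarrow> real ^ 'p \<Rightarrow> real ^ 'p" where
  "w_rho a \<rho> x = (\<chi> i. deriv (psi_star a) (\<rho> * \<bar>x $ i\<bar>))"

text \<open>
  Below, \<open>1\<close> is the all-ones vector and \<open>\<bar>x\<bar>\<close> the componentwise absolute value.
\<close>

definition mm_subproblem :: "(real ^ 'n \<Rightarrow> real) \<Rightarrow> real ^ 'p ^ 'n \<Rightarrow> real ^ 'n \<Rightarrow> real \<Rightarrow> real \<Rightarrow>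
    real ^ 'p \<Rightarrow> real \<Rightarrow> real \<Rightarrow> real ^ 'p \<Rightarrow> real ^ 'p \<Rightarrow> real" where
  "mm_subproblem f A b \<mu> lam w g1 g2 z x =
     F_mu f A b \<mu> x + lam * ((1 - w) \<bullet> \<bar>x\<bar>)
     + g1 / 2 * (norm (x - z))\<^sup>2 + g2 / 2 * (norm (A *v x - A *v z))\<^sup>2"

text \<open>
  The sequence \<open>x\<close> is generated by the method with proximal parameters \<open>\<gamma>1 k\<close>, \<open>\<gamma>2 k\<close>, lower
  bounds \<open>\<gamma>1lo\<close>, \<open>\<gamma>2lo\<close> and reduction factor \<open>\<theta>\<close>. Both updates use \<open>\<gamma>1 k\<close>.
\<close>

definition proximal_MM :: "(real ^ 'n \<Rightarrow> real) \<Rightarrow> real ^ 'p ^ 'n \<Rightarrow> real ^ 'n \<Rightarrow> (real ^ 'p) set \<Rightarrow>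
    real \<Rightarrow> real \<Rightarrow> real \<Rightarrow> real \<Rightarrow> real \<Rightarrow> real \<Rightarrow> real \<Rightarrow>
    (nat \<Rightarrow> real) \<Rightarrow> (nat \<Rightarrow> real) \<Rightarrow> (nat \<Rightarrow> real ^ 'p) \<Rightarrow> bool" where
  "proximal_MM f A b \<Omega> \<mu> a lam \<rho> \<theta> \<gamma>1lo \<gamma>2lo \<gamma>1 \<gamma>2 x \<longleftrightarrow>
     lam > 0 \<and> \<gamma>1 0 > 0 \<and> \<gamma>2 0 > 0 \<and> \<gamma>1lo > 0 \<and> \<gamma>2lo > 0 \<and> 0 < \<theta> \<and> \<theta> \<le> 1 \<and> \<rho> \<ge> 1 \<and> x 0 \<in> \<Omega> \<and>
     (\<forall>k. is_arg_min (mm_subproblem f A b \<mu> lam (w_rho a \<rho> (x k)) (\<gamma>1 k) (\<gamma>2 k) (x k))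
            (\<lambda>y. y \<in> \<Omega>) (x (Suc k)) \<and>
          \<gamma>1 (Suc k) = max \<gamma>1lo (\<theta> * \<gamma>1 k) \<and>
          \<gamma>2 (Suc k) = max \<gamma>2lo (\<theta> * \<gamma>1 k))"

end

theory Submission
  imports Defs
begin

text \<open>
  The function \<open>psi_star a\<close> is affine, with slopes 0 and 1, on the two sides of the transition
  interval \<open>[2 / (a + 1), 2 * a / (a + 1)]\<close>. The gap condition on the limit \<open>xbar\<close> says
  that every \<open>\<rho> * \<bar>xbar $ i\<bar>\<close> is off this interval, and by continuity the same holds, entry by
  entry and on the same side, for all points near \<open>xbar\<close>. This has two consequences. The weights of
  the method are eventually constant: 1 on the support of \<open>xbar\<close> and 0 off it. And near \<open>xbar\<close>
  the surrogate is, up to a constant and the constraint, the convex function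
  \[ G(y) = F_\mu(y) + \lambda \sum_{\bar x_i = 0} |y_i|. \]

  Hence the late iterations are proximal steps for the single function \<open>G\<close> over \<open>\<Omega>\<close>, with
  bounded proximal parameters. In the limit, \<open>xbar\<close> minimises \<open>G\<close> over \<open>\<Omega>\<close> up to a quadratic
  error; convexity removes the error (\<open>limit_of_proximal_steps_minimises\<close>). So \<open>xbar\<close> is
  a minimiser of \<open>G\<close> on \<open>\<Omega>\<close>, and therefore a local minimiser of the surrogate.

  For the problem with the zero norm, compare \<open>xbar\<close> with a nearby \<open>y \<in> \<Omega>\<close>. No entry in the support
  of \<open>xbar\<close> vanishes at \<open>y\<close>. If \<open>y\<close> has no further nonzero entry, then \<open>G\<close>
  agrees with \<open>F_mu\<close> at both points, so \<open>xbar\<close> is at least as good. Otherwise the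
  zero norm has jumped by at least 1, and the resulting penalty \<open>\<nu> = lam / \<rho>\<close> outweighs the small
  change of the continuous function \<open>F_mu\<close>.
\<close>

section \<open>Limits of proximal steps\<close>

lemma convex_on_power2_norm:
  fixes S :: "'a::real_normed_vector set"
  assumes "convex S"
  shows "convex_on S (\<lambda>x. (norm x)\<^sup>2)"
proof (rule convex_onI)
  fix t :: real and x y :: 'a
  assume t: "0 < t" "t < 1"
  have "norm ((1 - t) *\<^sub>R x + t *\<^sub>R y) \<le> (1 - t) * norm x + t * norm y"
    using norm_triangle_ineq[of "(1 - t) *\<^sub>R x" "t *\<^sub>R y"] t by simp
  then have "(norm ((1 - t) *\<^sub>R x + t *\<^sub>R y))\<^sup>2 \<le> ((1 - t) * norm x + t * norm y)\<^sup>2"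
    by (intro power_mono) auto
  also have "\<dots> \<le> (1 - t) * (norm x)\<^sup>2 + t * (norm y)\<^sup>2"
    using convex_onD[OF convex_power2, of t "norm x" "norm y"] t by simp
  finally show "(norm ((1 - t) *\<^sub>R x + t *\<^sub>R y))\<^sup>2 \<le> (1 - t) * (norm x)\<^sup>2 + t * (norm y)\<^sup>2" .
qed (fact assms)

text \<open>
  Moving a fraction \<open>t\<close> of the way towards \<open>y\<close> gains \<open>t * (G x - G y)\<close> by convexity but costs only
  \<open>M * t\<^sup>2 * (norm (y - x))\<^sup>2\<close>; let \<open>t\<close> tend to 0.
\<close>

lemma convex_minimiser_up_to_quadratic:
  fixes G :: "'a::real_normed_vector \<Rightarrow> real"
  assumes conv: "convex_on C G" and x: "x \<in> C" and y: "y \<in> C"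
    and min: "\<And>z. z \<in> C \<Longrightarrow> G x \<le> G z + M * (norm (z - x))\<^sup>2"
  shows "G x \<le> G y"
proof -
  have "G x \<le> G y + t * (M * (norm (y - x))\<^sup>2)" if t: "0 < t" "t < 1" for t
  proof -
    define z where "z = (1 - t) *\<^sub>R x + t *\<^sub>R y"
    have "z \<in> C"
      using convex_on_imp_convex[OF conv] x y t unfolding z_def convex_alt by auto
    have "norm (z - x) = t * norm (y - x)"
    proof -
      have "z - x = t *\<^sub>R (y - x)" by (simp add: z_def algebra_simps)
      then show ?thesis using t by simp
    qed
    then have "G x \<le> G z + M * (t * norm (y - x))\<^sup>2"
      using min[OF \<open>z \<in> C\<close>] by simp
    also have "G z \<le> (1 - t) * G x + t * G y"
      unfolding z_def using convex_onD[OF conv] x y t by simp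
    finally have "t * G x \<le> t * (G y + t * (M * (norm (y - x))\<^sup>2))"
      by (simp add: power2_eq_square algebra_simps)
    then show ?thesis using t by simp
  qed
  then have "\<forall>\<^sub>F t in at_right 0. G x \<le> G y + t * (M * (norm (y - x))\<^sup>2)"
    by (auto simp: eventually_at_right_field intro: exI[of _ 1])
  moreover have "((\<lambda>t. G y + t * (M * (norm (y - x))\<^sup>2)) \<longlongrightarrow> G y + 0 * (M * (norm (y - x))\<^sup>2))
      (at_right 0)"
    by (intro tendsto_intros)
  ultimately have "G x \<le> G y + 0 * (M * (norm (y - x))\<^sup>2)"
    by (intro tendsto_lowerbound) auto
  then show ?thesis by simp
qed

lemma limit_of_proximal_steps_minimises:
  fixes G :: "'a::real_normed_vector \<Rightarrow> real"
  assumes conv: "convex_on C G" and cont: "continuous_on UNIV G" and "closed C"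
    and lim: "x \<longlonglongrightarrow> xbar" and inC: "\<And>k. x k \<in> C"
    and step: "\<forall>\<^sub>F k in sequentially. \<forall>z\<in>C. G (x (Suc k)) \<le> G z + M * (norm (z - x k))\<^sup>2"
    and y: "y \<in> C"
  shows "G xbar \<le> G y"
proof (rule convex_minimiser_up_to_quadratic[OF conv _ y])
  show "xbar \<in> C"
    using \<open>closed C\<close> inC lim by (rule closed_sequentially)
  fix z assume z: "z \<in> C"
  have "(\<lambda>k. G (x (Suc k))) \<longlonglongrightarrow> G xbar"
    using continuous_on_tendsto_compose[OF cont LIMSEQ_Suc[OF lim]] by simp
  moreover have "(\<lambda>k. G z + M * (norm (z - x k))\<^sup>2) \<longlonglongrightarrow> G z + M * (norm (z - xbar))\<^sup>2"
    by (intro tendsto_intros lim)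
  moreover have "\<forall>\<^sub>F k in sequentially. G (x (Suc k)) \<le> G z + M * (norm (z - x k))\<^sup>2"
    using step by eventually_elim (use z in auto)
  ultimately show "G xbar \<le> G z + M * (norm (z - xbar))\<^sup>2"
    by (intro tendsto_le[OF sequentially_bot])
qed

section \<open>The surrogate away from its transition interval\<close>

lemma psi_star_below: "a > 1 \<Longrightarrow> s < 2 / (a + 1) \<Longrightarrow> psi_star a s = 0"
  by (simp add: psi_star_explicit)

lemma psi_star_above:
  assumes "a > 1" "2 * a / (a + 1) < s"
  shows "psi_star a s = s - 1"
proof -
  have "2 / (a + 1) < 2 * a / (a + 1)"
    using assms by (simp add: divide_strict_right_mono)
  then show ?thesis using assms by (simp add: psi_star_explicit)
qed

lemma deriv_psi_star_below:
  assumes "a > 1" "s < 2 / (a + 1)"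
  shows "deriv (psi_star a) s = 0"
proof (rule DERIV_imp_deriv)
  show "(psi_star a has_real_derivative 0) (at s)"
    by (rule has_field_derivative_transform_within_open[of "\<lambda>_. 0" _ _ "{..<2 / (a + 1)}"])
      (use assms in \<open>auto simp: psi_star_below\<close>)
qed

lemma deriv_psi_star_above:
  assumes "a > 1" "2 * a / (a + 1) < s"
  shows "deriv (psi_star a) s = 1"
proof (rule DERIV_imp_deriv)
  show "(psi_star a has_real_derivative 1) (at s)"
    by (rule has_field_derivative_transform_within_open[of "\<lambda>s. s - 1" _ _ "{2 * a / (a + 1)<..}"])
      (use assms in \<open>auto simp: psi_star_above intro!: derivative_eq_intros\<close>)
qed

text \<open>
  The point \<open>z\<close> decides on which side of the transition interval the entries of \<open>y\<close> have to lie;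
  \<open>z\<close> will be the limit and \<open>y\<close> a point near it.
\<close>

definition clear_of_transition :: "real \<Rightarrow> real \<Rightarrow> real ^ 'p \<Rightarrow> real ^ 'p \<Rightarrow> bool" where
  "clear_of_transition a \<rho> z y \<longleftrightarrow>
     (\<forall>i. if z $ i = 0 then \<rho> * \<bar>y $ i\<bar> < 2 / (a + 1) else 2 * a / (a + 1) < \<rho> * \<bar>y $ i\<bar>)"

definition off_support_norm1 :: "real ^ 'p \<Rightarrow> real ^ 'p \<Rightarrow> real" where
  "off_support_norm1 z y = (\<Sum>i | z $ i = 0. \<bar>y $ i\<bar>)"

lemma eventually_clear_of_transition:
  fixes z :: "real ^ 'p"
  assumes a: "a > 1" and \<rho>: "\<rho> > 0"
    and nz: "min_abs_nonzero z > ereal (2 * a / (\<rho> * (a + 1)))"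
  shows "\<forall>\<^sub>F y in nhds z. clear_of_transition a \<rho> z y"
  unfolding clear_of_transition_def
proof (rule eventually_all_finite)
  fix i
  have lim: "((\<lambda>y. \<rho> * \<bar>y $ i\<bar>) \<longlongrightarrow> \<rho> * \<bar>z $ i\<bar>) (nhds z)"
    by (intro tendsto_intros filterlim_ident)
  show "\<forall>\<^sub>F y in nhds z. if z $ i = 0 then \<rho> * \<bar>y $ i\<bar> < 2 / (a + 1)
      else 2 * a / (a + 1) < \<rho> * \<bar>y $ i\<bar>"
  proof (cases "z $ i = 0")
    case True
    then show ?thesis using order_tendstoD(2)[OF lim, of "2 / (a + 1)"] a by simp
  next
    case False
    then have "min_abs_nonzero z \<le> ereal \<bar>z $ i\<bar>"
      unfolding min_abs_nonzero_def by (intro INF_lower) simp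
    with nz have "2 * a / (\<rho> * (a + 1)) < \<bar>z $ i\<bar>"
      by (metis ereal_less(2) less_ereal.simps(1) order_less_le_trans)
    then have "\<rho> * (2 * a / (\<rho> * (a + 1))) < \<rho> * \<bar>z $ i\<bar>"
      using \<rho> by (intro mult_strict_left_mono)
    moreover have "\<rho> * (2 * a / (\<rho> * (a + 1))) = 2 * a / (a + 1)"
      using \<rho> by simp
    ultimately show ?thesis using order_tendstoD(1)[OF lim, of "2 * a / (a + 1)"] False by simp
  qed
qed

lemma nonzero_if_clear_of_transition:
  assumes "clear_of_transition a \<rho> z y" "a > 1" "z $ i \<noteq> 0"
  shows "y $ i \<noteq> 0"
proof
  assume "y $ i = 0"
  then have "2 * a / (a + 1) < 0"
    using assms by (auto simp: clear_of_transition_def dest: spec[of _ i])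
  then show False using assms(2) by (simp add: divide_less_0_iff)
qed

lemma w_rho_if_clear_of_transition:
  assumes "clear_of_transition a \<rho> z y" "a > 1"
  shows "w_rho a \<rho> y = (\<chi> i. if z $ i = 0 then 0 else 1)"
  using assms
  by (auto simp: w_rho_def clear_of_transition_def vec_eq_iff deriv_psi_star_below
      deriv_psi_star_above split: if_splits)

lemma weighted_abs_eq_off_support_norm1:
  "(1 - (\<chi> i. if z $ i = 0 then 0 else 1)) \<bullet> \<bar>y\<bar> = off_support_norm1 z y"
proof -
  have "(1 - (\<chi> i. if z $ i = 0 then 0 else 1)) \<bullet> \<bar>y\<bar> = (\<Sum>i\<in>UNIV. if z $ i = 0 then \<bar>y $ i\<bar> else 0)"
    by (auto simp: inner_vec_def abs_vec_def intro!: sum.cong)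
  then show ?thesis by (simp add: off_support_norm1_def sum.If_cases)
qed

text \<open>
  An entry in the support of \<open>z\<close> contributes
  \<open>lam * \<bar>y $ i\<bar> - lam / \<rho> * (\<rho> * \<bar>y $ i\<bar> - 1) = lam / \<rho>\<close>, so
  the surrogate counts these entries exactly.
\<close>

lemma Theta_if_clear_of_transition:
  fixes z :: "real ^ 'p"
  assumes clear: "clear_of_transition a \<rho> z y" and a: "a > 1" and \<rho>: "\<rho> > 0" and y: "y \<in> \<Omega>"
  shows "Theta f A b \<Omega> \<mu> a lam \<rho> y =
    ereal (F_mu f A b \<mu> y + lam * off_support_norm1 z y + lam / \<rho> * real (norm0 z))"
proof -
  have "lam * norm1 y - lam * inverse \<rho> * (\<Sum>i\<in>UNIV. psi_star a (\<rho> * \<bar>y $ i\<bar>)) =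
      (\<Sum>i\<in>UNIV. lam * \<bar>y $ i\<bar> - lam / \<rho> * psi_star a (\<rho> * \<bar>y $ i\<bar>))"
    by (simp add: norm1_def sum_subtractf sum_distrib_left divide_inverse mult.assoc)
  also have "\<dots> = (\<Sum>i\<in>UNIV. if z $ i = 0 then lam * \<bar>y $ i\<bar> else lam / \<rho>)"
  proof (rule sum.cong)
    fix i
    show "lam * \<bar>y $ i\<bar> - lam / \<rho> * psi_star a (\<rho> * \<bar>y $ i\<bar>) =
        (if z $ i = 0 then lam * \<bar>y $ i\<bar> else lam / \<rho>)"
    proof (cases "z $ i = 0")
      case True
      then have "psi_star a (\<rho> * \<bar>y $ i\<bar>) = 0"
        using clear a by (auto simp: clear_of_transition_def intro!: psi_star_below)
      then show ?thesis using True by simp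
    next
      case False
      then have "psi_star a (\<rho> * \<bar>y $ i\<bar>) = \<rho> * \<bar>y $ i\<bar> - 1"
        using clear a by (auto simp: clear_of_transition_def intro!: psi_star_above)
      then show ?thesis using False \<rho> by (simp add: right_diff_distrib)
    qed
  qed simp
  also have "\<dots> = lam * off_support_norm1 z y + lam / \<rho> * real (norm0 z)"
    by (simp add: sum.If_cases off_support_norm1_def norm0_def sum_distrib_left Collect_neg_eq
        flip: Collect_neg_eq)
  finally show ?thesis
    using y by (simp add: Theta_def indicator_fun_def algebra_simps)
qed

section \<open>The limit minimises the reduced convex problem\<close>

lemma convex_on_F_mu:
  assumes f: "convex_on UNIV f" and "\<mu> \<ge> 0"
  shows "convex_on UNIV (F_mu f A b \<mu>)"
proof -
  have "convex_on UNIV (\<lambda>x. f (A *v x - b))"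
  proof (rule convex_onI)
    fix t :: real and x y
    assume t: "0 < t" "t < 1"
    have "A *v ((1 - t) *\<^sub>R x + t *\<^sub>R y) - b = (1 - t) *\<^sub>R (A *v x - b) + t *\<^sub>R (A *v y - b)"
      by (simp add: matrix_vector_right_distrib matrix_vector_mult_scaleR algebra_simps)
    then show "f (A *v ((1 - t) *\<^sub>R x + t *\<^sub>R y) - b)
        \<le> (1 - t) * f (A *v x - b) + t * f (A *v y - b)"
      using convex_onD[OF f, of t] t by simp
  qed simp
  then have "convex_on UNIV (\<lambda>x. f (A *v x - b) + \<mu> / 2 * (norm x)\<^sup>2)"
    using \<open>\<mu> \<ge> 0\<close> by (intro convex_on_add convex_on_cmul convex_on_power2_norm) auto
  then show ?thesis by (simp add: F_mu_def[abs_def])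
qed

lemma convex_on_off_support_norm1:
  fixes z :: "real ^ 'p"
  shows "convex_on UNIV (off_support_norm1 z)"
proof (rule convex_onI)
  fix t :: real and x y :: "real ^ 'p"
  assume t: "0 < t" "t < 1"
  have "off_support_norm1 z ((1 - t) *\<^sub>R x + t *\<^sub>R y)
      \<le> (\<Sum>i | z $ i = 0. (1 - t) * \<bar>x $ i\<bar> + t * \<bar>y $ i\<bar>)"
    unfolding off_support_norm1_def
  proof (rule sum_mono)
    fix i
    show "\<bar>((1 - t) *\<^sub>R x + t *\<^sub>R y) $ i\<bar> \<le> (1 - t) * \<bar>x $ i\<bar> + t * \<bar>y $ i\<bar>"
      using abs_triangle_ineq[of "(1 - t) * x $ i" "t * y $ i"] t by (simp add: abs_mult)
  qed
  then show "off_support_norm1 z ((1 - t) *\<^sub>R x + t *\<^sub>R y)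
      \<le> (1 - t) * off_support_norm1 z x + t * off_support_norm1 z y"
    by (simp add: off_support_norm1_def sum.distrib sum_distrib_left)
qed simp

lemma proximal_parameters_bounded:
  assumes "proximal_MM f A b \<Omega> \<mu> a lam \<rho> \<theta> \<gamma>1lo \<gamma>2lo \<gamma>1 \<gamma>2 x"
  obtains B where "\<And>k. \<gamma>1 k \<le> B" "\<And>k. \<gamma>2 k \<le> B"
proof -
  have \<theta>: "0 < \<theta>" "\<theta> \<le> 1" and pos: "\<gamma>1 0 > 0" "\<gamma>1lo > 0"
    and \<gamma>1: "\<And>k. \<gamma>1 (Suc k) = max \<gamma>1lo (\<theta> * \<gamma>1 k)"
    and \<gamma>2: "\<And>k. \<gamma>2 (Suc k) = max \<gamma>2lo (\<theta> * \<gamma>1 k)"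
    using assms by (auto simp: proximal_MM_def)
  define B where "B = max (\<gamma>1 0) \<gamma>1lo"
  have bound: "0 < \<gamma>1 k \<and> \<gamma>1 k \<le> B" for k
  proof (induction k)
    case (Suc k)
    then have "\<theta> * \<gamma>1 k \<le> 1 * B" using \<theta> by (intro mult_mono) auto
    then show ?case using pos by (auto simp: \<gamma>1 B_def)
  qed (use pos in \<open>simp add: B_def\<close>)
  have "\<gamma>2 k \<le> max (\<gamma>2 0) (max \<gamma>2lo B)" for k
  proof (cases k)
    case (Suc j)
    have "\<theta> * \<gamma>1 j \<le> 1 * B" using \<theta> bound[of j] by (intro mult_mono) auto
    then show ?thesis using Suc by (auto simp: \<gamma>2)
  qed simp
  moreover have "\<gamma>1 k \<le> max (\<gamma>2 0) (max \<gamma>2lo B)" for k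
    using bound[of k] by auto
  ultimately show thesis by (rule that[rotated])
qed

lemma proximal_MM_in_feasible_set:
  assumes "proximal_MM f A b \<Omega> \<mu> a lam \<rho> \<theta> \<gamma>1lo \<gamma>2lo \<gamma>1 \<gamma>2 x"
  shows "x k \<in> \<Omega>"
  using assms by (cases k) (auto simp: proximal_MM_def is_arg_min_def)

text \<open>
  Near \<open>xbar\<close> the weights are constant, so from some index on each iteration minimises the same
  convex function plus a proximal term, which is at most a fixed multiple of the squared distance
  to the current iterate.
\<close>

lemma proximal_MM_limit_minimises:
  fixes f :: "real ^ 'n \<Rightarrow> real" and A :: "real ^ 'p ^ 'n"
  assumes f: "convex_on UNIV f" and \<Omega>: "closed \<Omega>" "convex \<Omega>"
    and \<mu>: "\<mu> \<ge> 0" and a: "a > 1"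
    and alg: "proximal_MM f A b \<Omega> \<mu> a lam \<rho> \<theta> \<gamma>1lo \<gamma>2lo \<gamma>1 \<gamma>2 x"
    and lim: "x \<longlonglongrightarrow> xbar"
    and clear: "\<forall>\<^sub>F y in nhds xbar. clear_of_transition a \<rho> xbar y"
    and y: "y \<in> \<Omega>"
  shows "F_mu f A b \<mu> xbar + lam * off_support_norm1 xbar xbar
    \<le> F_mu f A b \<mu> y + lam * off_support_norm1 xbar y"
proof -
  define G where "G z = F_mu f A b \<mu> z + lam * off_support_norm1 xbar z" for z
  have "lam > 0" and \<gamma>_init: "\<gamma>1 0 > 0" "\<gamma>2 0 > 0" "\<gamma>1lo > 0" "\<gamma>2lo > 0"
    and \<gamma>_Suc: "\<And>k. \<gamma>1 (Suc k) = max \<gamma>1lo (\<theta> * \<gamma>1 k)" "\<And>k. \<gamma>2 (Suc k) = max \<gamma>2lo (\<theta> * \<gamma>1 k)"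
    and step: "\<And>k. is_arg_min (mm_subproblem f A b \<mu> lam (w_rho a \<rho> (x k)) (\<gamma>1 k) (\<gamma>2 k) (x k))
            (\<lambda>y. y \<in> \<Omega>) (x (Suc k))"
    using alg by (auto simp: proximal_MM_def)
  have \<gamma>_pos: "\<gamma>1 k > 0" "\<gamma>2 k > 0" for k
    using \<gamma>_init by (cases k; auto simp: \<gamma>_Suc)+
  have conv: "convex_on UNIV G"
    unfolding G_def using f \<mu> \<open>lam > 0\<close>
    by (intro convex_on_add convex_on_cmul convex_on_F_mu convex_on_off_support_norm1) auto
  obtain B where B: "\<And>k. \<gamma>1 k \<le> B" "\<And>k. \<gamma>2 k \<le> B"
    using alg by (rule proximal_parameters_bounded) blast
  obtain K where K: "\<And>z. norm (A *v z) \<le> norm z * K"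
    using bounded_linear.bounded[OF matrix_vector_mul_bounded_linear[of A]] by blast
  have "\<forall>\<^sub>F k in sequentially. clear_of_transition a \<rho> xbar (x k)"
    using clear lim by (auto simp: filterlim_iff)
  then have "\<forall>\<^sub>F k in sequentially.
      \<forall>z\<in>\<Omega>. G (x (Suc k)) \<le> G z + (B / 2 + B / 2 * K\<^sup>2) * (norm (z - x k))\<^sup>2"
  proof eventually_elim
    case (elim k)
    have sub: "mm_subproblem f A b \<mu> lam (w_rho a \<rho> (x k)) (\<gamma>1 k) (\<gamma>2 k) (x k) z =
        G z + \<gamma>1 k / 2 * (norm (z - x k))\<^sup>2 + \<gamma>2 k / 2 * (norm (A *v (z - x k)))\<^sup>2" for z
      unfolding mm_subproblem_def w_rho_if_clear_of_transition[OF elim a] G_def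
        weighted_abs_eq_off_support_norm1
      by (simp add: matrix_vector_mult_diff_distrib)
    show ?case
    proof
      fix z assume z: "z \<in> \<Omega>"
      have "G (x (Suc k)) \<le> G (x (Suc k)) + \<gamma>1 k / 2 * (norm (x (Suc k) - x k))\<^sup>2
          + \<gamma>2 k / 2 * (norm (A *v (x (Suc k) - x k)))\<^sup>2"
        using \<gamma>_pos[of k] by simp
      also have "\<dots> \<le> G z + \<gamma>1 k / 2 * (norm (z - x k))\<^sup>2 + \<gamma>2 k / 2 * (norm (A *v (z - x k)))\<^sup>2"
        using step[of k] z unfolding is_arg_min_def sub by (auto simp: not_less)
      also have "\<dots> \<le> G z + B / 2 * (norm (z - x k))\<^sup>2 + B / 2 * (norm (z - x k) * K)\<^sup>2"
        using B[of k] \<gamma>_pos[of k] K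
        by (intro add_mono mult_mono power_mono) auto
      finally show "G (x (Suc k)) \<le> G z + (B / 2 + B / 2 * K\<^sup>2) * (norm (z - x k))\<^sup>2"
        by (simp add: power_mult_distrib algebra_simps)
    qed
  qed
  then have "G xbar \<le> G y"
    using proximal_MM_in_feasible_set[OF alg] convex_on_subset[OF conv] \<Omega> conv lim y
    by (intro limit_of_proximal_steps_minimises[of \<Omega> G x]) (auto intro: convex_on_continuous)
  then show ?thesis by (simp add: G_def)
qed

section \<open>Local minimality of the limit\<close>

lemma local_minimum_onI:
  assumes "x \<in> S" and "\<bar>g x\<bar> \<noteq> \<infinity>" and "\<forall>\<^sub>F y in nhds x. y \<in> S \<longrightarrow> g x \<le> g y"
  shows "local_minimum_on S g x"
  using assms by (auto simp: local_minimum_on_def eventually_nhds_metric dist_commute)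

lemma off_support_norm1_eq_0:
  assumes "{i. y $ i \<noteq> 0} \<subseteq> {i. z $ i \<noteq> 0}"
  shows "off_support_norm1 z y = 0"
  using assms by (auto simp: off_support_norm1_def intro!: sum.neutral)

theorem corollary4p1:
  fixes f :: "real ^ 'n \<Rightarrow> real" and A :: "real ^ 'p ^ 'n" and b :: "real ^ 'n"
    and \<Omega> :: "(real ^ 'p) set" and \<mu> a lam \<rho> \<theta> \<gamma>1lo \<gamma>2lo :: real
    and \<gamma>1 \<gamma>2 :: "nat \<Rightarrow> real" and x :: "nat \<Rightarrow> real ^ 'p" and xbar :: "real ^ 'p"
  assumes f_nonneg: "\<And>z. f z \<ge> 0"
    and f_convex: "convex_on UNIV f"
    and f_plq: "piecewise_linear_quadratic f"
    and \<Omega>_poly: "polyhedron \<Omega>" and \<Omega>_nonempty: "\<Omega> \<noteq> {}"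
    and mu: "\<mu> > 0" and a: "a > 1"
    and alg: "proximal_MM f A b \<Omega> \<mu> a lam \<rho> \<theta> \<gamma>1lo \<gamma>2lo \<gamma>1 \<gamma>2 x"
    and lim: "x \<longlonglongrightarrow> xbar"
    and nz: "min_abs_nonzero xbar > ereal (2 * a / (\<rho> * (a + 1)))"
  shows "local_minimum_on UNIV (Theta f A b \<Omega> \<mu> a lam \<rho>) xbar \<and>
    ((\<forall>v1 v2. v1 + v2 = 0 \<and> v1 \<in> normal_cone \<Omega> xbar \<and>
         v2 \<in> limiting_subdifferential (\<lambda>y. ereal (real (norm0 y))) xbar
         \<longrightarrow> v1 = 0 \<and> v2 = 0)
     \<longrightarrow> local_minimum_on \<Omega>
          (\<lambda>y. ereal (f (A *v y - b) + \<mu> / 2 * (norm y)\<^sup>2 + lam / \<rho> * real (norm0 y))) xbar)"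
proof -
  let ?F = "F_mu f A b \<mu>"
  have lam: "lam > 0" and \<rho>: "\<rho> > 0"
    using alg by (auto simp: proximal_MM_def)
  note \<Omega> = polyhedron_imp_closed[OF \<Omega>_poly] polyhedron_imp_convex[OF \<Omega>_poly]
  have xbar: "xbar \<in> \<Omega>"
    using \<Omega>(1) proximal_MM_in_feasible_set[OF alg] lim by (rule closed_sequentially)
  have clear: "\<forall>\<^sub>F y in nhds xbar. clear_of_transition a \<rho> xbar y"
    using a \<rho> nz by (rule eventually_clear_of_transition)
  have min: "?F xbar + lam * off_support_norm1 xbar xbar \<le> ?F y + lam * off_support_norm1 xbar y"
    if "y \<in> \<Omega>" for y
    using proximal_MM_limit_minimises[OF f_convex \<Omega> less_imp_le[OF mu] a alg lim clear that] .
  have "local_minimum_on UNIV (Theta f A b \<Omega> \<mu> a lam \<rho>) xbar"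
  proof (rule local_minimum_onI)
    note Theta = Theta_if_clear_of_transition[OF _ a \<rho>, where f = f and z = xbar and \<Omega> = \<Omega>]
    have Theta_xbar: "Theta f A b \<Omega> \<mu> a lam \<rho> xbar =
        ereal (?F xbar + lam * off_support_norm1 xbar xbar + lam / \<rho> * real (norm0 xbar))"
      using eventually_nhds_x_imp_x[OF clear] xbar by (rule Theta)
    then show "\<bar>Theta f A b \<Omega> \<mu> a lam \<rho> xbar\<bar> \<noteq> \<infinity>" by simp
    show "\<forall>\<^sub>F y in nhds xbar. y \<in> UNIV \<longrightarrow>
        Theta f A b \<Omega> \<mu> a lam \<rho> xbar \<le> Theta f A b \<Omega> \<mu> a lam \<rho> y"
      using clear
    proof eventually_elim
      case (elim y)
      show ?case
      proof (cases "y \<in> \<Omega>")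
        case True
        then show ?thesis using min[OF True] unfolding Theta_xbar Theta[OF elim True] by simp
      next
        case False
        then show ?thesis by (simp add: Theta_def indicator_fun_def)
      qed
    qed
  qed simp
  moreover have "local_minimum_on \<Omega> (\<lambda>y. ereal (?F y + lam / \<rho> * real (norm0 y))) xbar"
  proof (rule local_minimum_onI)
    have "continuous_on UNIV ?F"
      using convex_on_F_mu[OF f_convex less_imp_le[OF mu]] by (intro convex_on_continuous) auto
    then have "(?F \<longlongrightarrow> ?F xbar) (nhds xbar)"
      by (simp add: continuous_on_eq_continuous_at isCont_def tendsto_at_iff_tendsto_nhds)
    \<comment> \<open>The margin \<open>lam / \<rho>\<close> is the price of one additional nonzero entry.\<close>
    then have "\<forall>\<^sub>F y in nhds xbar. ?F xbar - lam / \<rho> < ?F y"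
      by (rule order_tendstoD) (use lam \<rho> in simp)
    then show "\<forall>\<^sub>F y in nhds xbar. y \<in> \<Omega> \<longrightarrow> ereal (?F xbar + lam / \<rho> * real (norm0 xbar))
        \<le> ereal (?F y + lam / \<rho> * real (norm0 y))"
      using clear
    proof eventually_elim
      case (elim y)
      have supp: "{i. xbar $ i \<noteq> 0} \<subseteq> {i. y $ i \<noteq> 0}"
        using nonzero_if_clear_of_transition[OF elim(2) a] by blast
      show ?case
      proof (intro impI, cases "{i. xbar $ i \<noteq> 0} = {i. y $ i \<noteq> 0}")
        case True
        moreover assume "y \<in> \<Omega>"
        ultimately have "?F xbar \<le> ?F y"
          using min[of y] off_support_norm1_eq_0[of y xbar] off_support_norm1_eq_0[of xbar xbar]
          by simp
        then show "ereal (?F xbar + lam / \<rho> * real (norm0 xbar))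
            \<le> ereal (?F y + lam / \<rho> * real (norm0 y))"
          using True by (simp add: norm0_def)
      next
        case False
        with supp have "norm0 xbar < norm0 y"
          unfolding norm0_def by (intro psubset_card_mono) auto
        then have "lam / \<rho> * (real (norm0 xbar) + 1) \<le> lam / \<rho> * real (norm0 y)"
          using lam \<rho> by (intro mult_left_mono) auto
        then show "ereal (?F xbar + lam / \<rho> * real (norm0 xbar))
            \<le> ereal (?F y + lam / \<rho> * real (norm0 y))"
          using elim(1) by (simp add: algebra_simps)
      qed
    qed
  qed (use xbar in auto)
  ultimately show ?thesis by (simp add: F_mu_def)
qed

end
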